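(* Let $\alpha_1,\alpha_2,\alpha_3,\alpha_4$ be distinct null points, with diagonal spreads $$P=S(\alpha_1\alpha_2,\alpha_3\alpha_4),\qquad R=S(\alpha_1\alpha_3,\alpha_2\alpha_4),\qquad T=S(\alpha_1\alpha_4,\alpha_2\alpha_3).$$ Then $$PR+RT+TP=48\qquad\text{and}\qquad PRT=64.$$
   Context: Let $\mathbb F$ be a field of characteristic not two. A 3-proportion $x:y:z$ is a triple of elements of $\mathbb F$, not all zero, up to a common non-zero scalar. A point $a=[x:y:z]$ and a line $L=(l:m:n)$ are both 3-proportions. The point $[x:y:z]$ lies on the line $(l:m:n)$ when $lx+my-nz=0$. For distinct points $a,b$, the join $ab$ is the unique line through both. A point $[x:y:z]$ is null when $x^2+y^2-z^2=0$; a line $(l:m:n)$ is null when $l^2+m^2-n^2=0$. The join of two distinct null points is always a non-null line. The spread between non-null lines $L_1=(l_1:m_1:n_1)$, $L_2=(l_2:m_2:n_2)$ is $$S(L_1,L_2)=1-\frac{(l_1l_2+m_1m_2-n_1n_2)^2}{(l_1^2+m_1^2-n_1^2)(l_2^2+m_2^2-n_2^2)}.$$ *)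

theory Defs
  imports Complex_Main "HOL-Computational_Algebra.Computational_Algebra"
begin

definition proportional ::
    "'a::field \<times> 'a \<times> 'a \<Rightarrow> 'a \<times> 'a \<times> 'a \<Rightarrow> bool" where
  "proportional = (\<lambda>(x, y, z) (x', y', z').
     (x, y, z) \<noteq> (0, 0, 0) \<and> (x', y', z') \<noteq> (0, 0, 0) \<and>
     (\<exists>c. c \<noteq> 0 \<and> x' = c * x \<and> y' = c * y \<and> z' = c * z))"

lemma proportional_triple:
  "proportional (x, y, z) (x', y', z') \<longleftrightarrow>
     (x, y, z) \<noteq> (0, 0, 0) \<and> (x', y', z') \<noteq> (0, 0, 0) \<and>
     (\<exists>c. c \<noteq> 0 \<and> x' = c * x \<and> y' = c * y \<and> z' = c * z)"
  by (simp add: proportional_def)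

lemma part_equivp_proportional: "part_equivp (proportional :: 'a::field \<times> 'a \<times> 'a \<Rightarrow> _)"
proof (rule part_equivpI)
  have "proportional (1::'a, 0, 0) (1, 0, 0)"
    unfolding proportional_def by (auto intro!: exI[of _ 1])
  then show "\<exists>p :: 'a \<times> 'a \<times> 'a. proportional p p" by blast
next
  show "symp (proportional :: 'a \<times> 'a \<times> 'a \<Rightarrow> _)"
  proof (rule sympI)
    fix p q :: "'a \<times> 'a \<times> 'a"
    assume pq: "proportional p q"
    obtain x y z where p: "p = (x, y, z)" by (metis prod_cases3)
    obtain x' y' z' where q: "q = (x', y', z')" by (metis prod_cases3)
    from pq obtain c where c: "c \<noteq> 0" "x' = c * x" "y' = c * y" "z' = c * z"
      unfolding p q proportional_def by auto
    then have "inverse c \<noteq> 0 \<and> x = inverse c * x' \<and> y = inverse c * y' \<and> z = inverse c * z'"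
      by (simp add: mult.assoc[symmetric])
    then show "proportional q p" using pq unfolding p q proportional_triple by blast
  qed
next
  show "transp (proportional :: 'a \<times> 'a \<times> 'a \<Rightarrow> _)"
  proof (rule transpI)
    fix p q r :: "'a \<times> 'a \<times> 'a"
    assume pq: "proportional p q" and qr: "proportional q r"
    obtain x y z where p: "p = (x, y, z)" by (metis prod_cases3)
    obtain x' y' z' where q: "q = (x', y', z')" by (metis prod_cases3)
    obtain x'' y'' z'' where r: "r = (x'', y'', z'')" by (metis prod_cases3)
    from pq obtain c where c: "c \<noteq> 0" "x' = c * x" "y' = c * y" "z' = c * z"
      unfolding p q proportional_def by auto
    from qr obtain d where d: "d \<noteq> 0" "x'' = d * x'" "y'' = d * y'" "z'' = d * z'"
      unfolding q r proportional_def by auto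
    have "d * c \<noteq> 0 \<and> x'' = (d * c) * x \<and> y'' = (d * c) * y \<and> z'' = (d * c) * z"
      using c d by (simp add: mult.assoc)
    then show "proportional p r" using pq qr unfolding p q r proportional_triple by blast
  qed
qed

quotient_type (overloaded) 'a proportion = "'a::field \<times> 'a \<times> 'a" / partial: proportional
  by (rule part_equivp_proportional)

type_synonym 'a point = "'a proportion"
type_synonym 'a line = "'a proportion"

lift_definition lies_on :: "'a::field point \<Rightarrow> 'a line \<Rightarrow> bool"
  is "\<lambda>(x, y, z) (l, m, n). l * x + m * y - n * z = 0"
proof -
  fix p p' q q' :: "'a \<times> 'a \<times> 'a"
  assume pp: "proportional p p'" and qq: "proportional q q'"
  obtain x y z where p: "p = (x, y, z)" by (metis prod_cases3)
  obtain x' y' z' where p': "p' = (x', y', z')" by (metis prod_cases3)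
  obtain l m n where q: "q = (l, m, n)" by (metis prod_cases3)
  obtain l' m' n' where q': "q' = (l', m', n')" by (metis prod_cases3)
  from pp obtain c where c: "c \<noteq> 0" "x' = c * x" "y' = c * y" "z' = c * z"
    unfolding p p' proportional_def by auto
  from qq obtain d where d: "d \<noteq> 0" "l' = d * l" "m' = d * m" "n' = d * n"
    unfolding q q' proportional_def by auto
  have "l' * x' + m' * y' - n' * z' = (c * d) * (l * x + m * y - n * z)"
    unfolding c d by (simp add: algebra_simps)
  then show "(case p of (x, y, z) \<Rightarrow> \<lambda>(l, m, n). l * x + m * y - n * z = 0) q =
    (case p' of (x, y, z) \<Rightarrow> \<lambda>(l, m, n). l * x + m * y - n * z = 0) q'"
    using c(1) d(1) unfolding p p' q q' by (simp del: right_minus_eq)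
qed

lift_definition null :: "'a::field proportion \<Rightarrow> bool"
  is "\<lambda>(x, y, z). x\<^sup>2 + y\<^sup>2 - z\<^sup>2 = 0"
proof -
  fix p p' :: "'a \<times> 'a \<times> 'a"
  assume pp: "proportional p p'"
  obtain x y z where p: "p = (x, y, z)" by (metis prod_cases3)
  obtain x' y' z' where p': "p' = (x', y', z')" by (metis prod_cases3)
  from pp obtain c where c: "c \<noteq> 0" "x' = c * x" "y' = c * y" "z' = c * z"
    unfolding p p' proportional_def by auto
  have "x'\<^sup>2 + y'\<^sup>2 - z'\<^sup>2 = c\<^sup>2 * (x\<^sup>2 + y\<^sup>2 - z\<^sup>2)"
    unfolding c by (simp add: algebra_simps power2_eq_square)
  then show "(case p of (x, y, z) \<Rightarrow> x\<^sup>2 + y\<^sup>2 - z\<^sup>2 = 0) =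
    (case p' of (x, y, z) \<Rightarrow> x\<^sup>2 + y\<^sup>2 - z\<^sup>2 = 0)"
    using c(1) unfolding p p' by (simp del: right_minus_eq)
qed

definition join :: "'a::field point \<Rightarrow> 'a point \<Rightarrow> 'a line" where
  "join a b = (THE L. lies_on a L \<and> lies_on b L)"

text \<open>
  The spread is meaningful for non-null lines only; if one of the lines is null,
  the denominator vanishes and the value is 1 by the convention for division by zero.
\<close>

lift_definition spread :: "'a::field line \<Rightarrow> 'a line \<Rightarrow> 'a"
  is "\<lambda>(l\<^sub>1, m\<^sub>1, n\<^sub>1) (l\<^sub>2, m\<^sub>2, n\<^sub>2).
        1 - (l\<^sub>1 * l\<^sub>2 + m\<^sub>1 * m\<^sub>2 - n\<^sub>1 * n\<^sub>2)\<^sup>2 /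
            ((l\<^sub>1\<^sup>2 + m\<^sub>1\<^sup>2 - n\<^sub>1\<^sup>2) * (l\<^sub>2\<^sup>2 + m\<^sub>2\<^sup>2 - n\<^sub>2\<^sup>2))"
proof -
  fix p p' q q' :: "'a \<times> 'a \<times> 'a"
  assume pp: "proportional p p'" and qq: "proportional q q'"
  obtain x y z where p: "p = (x, y, z)" by (metis prod_cases3)
  obtain x' y' z' where p': "p' = (x', y', z')" by (metis prod_cases3)
  obtain l m n where q: "q = (l, m, n)" by (metis prod_cases3)
  obtain l' m' n' where q': "q' = (l', m', n')" by (metis prod_cases3)
  from pp obtain c where c: "c \<noteq> 0" "x' = c * x" "y' = c * y" "z' = c * z"
    unfolding p p' proportional_def by auto
  from qq obtain d where d: "d \<noteq> 0" "l' = d * l" "m' = d * m" "n' = d * n"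
    unfolding q q' proportional_def by auto
  have num: "(x' * l' + y' * m' - z' * n')\<^sup>2 = (c * d)\<^sup>2 * (x * l + y * m - z * n)\<^sup>2"
    unfolding c d power_mult_distrib[symmetric] by (simp add: algebra_simps)
  have "(x'\<^sup>2 + y'\<^sup>2 - z'\<^sup>2) = c\<^sup>2 * (x\<^sup>2 + y\<^sup>2 - z\<^sup>2)"
    "(l'\<^sup>2 + m'\<^sup>2 - n'\<^sup>2) = d\<^sup>2 * (l\<^sup>2 + m\<^sup>2 - n\<^sup>2)"
    unfolding c d by (simp_all add: algebra_simps power2_eq_square)
  then have den: "(x'\<^sup>2 + y'\<^sup>2 - z'\<^sup>2) * (l'\<^sup>2 + m'\<^sup>2 - n'\<^sup>2) =
    (c * d)\<^sup>2 * ((x\<^sup>2 + y\<^sup>2 - z\<^sup>2) * (l\<^sup>2 + m\<^sup>2 - n\<^sup>2))"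
    by (simp add: power_mult_distrib mult_ac)
  have "(c * d)\<^sup>2 \<noteq> 0" using c(1) d(1) by simp
  then show "(case p of (l\<^sub>1, m\<^sub>1, n\<^sub>1) \<Rightarrow> \<lambda>(l\<^sub>2, m\<^sub>2, n\<^sub>2).
        1 - (l\<^sub>1 * l\<^sub>2 + m\<^sub>1 * m\<^sub>2 - n\<^sub>1 * n\<^sub>2)\<^sup>2 /
            ((l\<^sub>1\<^sup>2 + m\<^sub>1\<^sup>2 - n\<^sub>1\<^sup>2) * (l\<^sub>2\<^sup>2 + m\<^sub>2\<^sup>2 - n\<^sub>2\<^sup>2))) q =
    (case p' of (l\<^sub>1, m\<^sub>1, n\<^sub>1) \<Rightarrow> \<lambda>(l\<^sub>2, m\<^sub>2, n\<^sub>2).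
        1 - (l\<^sub>1 * l\<^sub>2 + m\<^sub>1 * m\<^sub>2 - n\<^sub>1 * n\<^sub>2)\<^sup>2 /
            ((l\<^sub>1\<^sup>2 + m\<^sub>1\<^sup>2 - n\<^sub>1\<^sup>2) * (l\<^sub>2\<^sup>2 + m\<^sub>2\<^sup>2 - n\<^sub>2\<^sup>2))) q'"
    unfolding p p' q q' by (simp add: num den del: power_mult_distrib)
qed

definition cross :: "'a::field \<times> 'a \<times> 'a \<Rightarrow> 'a \<times> 'a \<times> 'a \<Rightarrow> 'a \<times> 'a \<times> 'a" where
  "cross = (\<lambda>(x, y, z) (x', y', z').
     (y * z' - z * y', z * x' - x * z', x * y' - y * x'))"

lemma proportional_iff_cross:
  "proportional p q \<longleftrightarrow> p \<noteq> (0, 0, 0) \<and> q \<noteq> (0, 0, 0) \<and> cross p q = (0, 0, 0)"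
proof -
  obtain x y z where p: "p = (x, y, z)" by (metis prod_cases3)
  obtain x' y' z' where q: "q = (x', y', z')" by (metis prod_cases3)
  show ?thesis
  proof
    assume "proportional p q"
    then show "p \<noteq> (0, 0, 0) \<and> q \<noteq> (0, 0, 0) \<and> cross p q = (0, 0, 0)"
      unfolding p q proportional_def cross_def by auto
  next
    assume h: "p \<noteq> (0, 0, 0) \<and> q \<noteq> (0, 0, 0) \<and> cross p q = (0, 0, 0)"
    then have e: "y * z' = z * y'" "z * x' = x * z'" "x * y' = y * x'"
      unfolding p q cross_def by auto
    have "\<exists>c. x' = c * x \<and> y' = c * y \<and> z' = c * z"
    proof -
      consider "x \<noteq> 0" | "y \<noteq> 0" | "z \<noteq> 0" using h p by auto
      then show ?thesis
      proof cases
        case 1 then show ?thesis using e by (intro exI[of _ "x' / x"]) (simp add: field_simps)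
      next
        case 2 then show ?thesis using e by (intro exI[of _ "y' / y"]) (simp add: field_simps)
      next
        case 3 then show ?thesis using e by (intro exI[of _ "z' / z"]) (simp add: field_simps)
      qed
    qed
    then obtain c where c: "x' = c * x" "y' = c * y" "z' = c * z" by blast
    moreover have "c \<noteq> 0" using h c q by auto
    ultimately show "proportional p q" using h unfolding p q proportional_triple by blast
  qed
qed

text \<open>
  The cross product of two independent triples, with the last entry negated to match
  the sign in the incidence relation, represents their join.
\<close>

lemma lies_on_both_iff:
  fixes x y z x' y' z' l m n :: "'a::field"
  assumes "cross (x, y, z) (x', y', z') \<noteq> (0, 0, 0)" and "(l, m, n) \<noteq> (0, 0, 0)"
  shows "l * x + m * y - n * z = 0 \<and> l * x' + m * y' - n * z' = 0 \<longleftrightarrow>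
    proportional (y * z' - z * y', z * x' - x * z', y * x' - x * y') (l, m, n)"
    (is "?L \<longleftrightarrow> proportional (?a, ?b, ?c) _")
proof
  assume h: ?L
  have "?b * n - ?c * m = 0" using h by algebra
  moreover have "?c * l - ?a * n = 0" using h by algebra
  moreover have "?a * m - ?b * l = 0" using h by algebra
  ultimately show "proportional (?a, ?b, ?c) (l, m, n)"
    using assms unfolding proportional_iff_cross cross_def by auto
next
  assume "proportional (?a, ?b, ?c) (l, m, n)"
  then obtain c where "l = c * ?a" "m = c * ?b" "n = c * ?c"
    unfolding proportional_triple by blast
  then show ?L by (simp only:) (simp add: algebra_simps)
qed

lemma join_exists_unique:
  fixes a b :: "'a::field point"
  assumes "a \<noteq> b"
  shows "\<exists>!L. lies_on a L \<and> lies_on b L"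
proof -
  have "\<exists>J. \<forall>L. lies_on a L \<and> lies_on b L \<longleftrightarrow> J = L"
    using assms
  proof transfer
    fix p q :: "'a \<times> 'a \<times> 'a"
    assume pp: "proportional p p" and qq: "proportional q q" and ne: "\<not> proportional p q"
    obtain x y z where p: "p = (x, y, z)" by (metis prod_cases3)
    obtain x' y' z' where q: "q = (x', y', z')" by (metis prod_cases3)
    let ?J = "(y * z' - z * y', z * x' - x * z', y * x' - x * y')"
    let ?on = "\<lambda>p L. (case p of (x, y, z) \<Rightarrow> \<lambda>(l, m, n). l * x + m * y - n * z = 0) L"
    have cr: "cross (x, y, z) (x', y', z') \<noteq> (0, 0, 0)"
      using pp qq ne unfolding proportional_iff_cross p q by auto
    then have "?J \<noteq> (0, 0, 0)" unfolding cross_def by auto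
    then have JJ: "proportional ?J ?J"
      unfolding proportional_iff_cross by (simp add: cross_def mult.commute)
    have "?on p L \<and> ?on q L \<longleftrightarrow> proportional ?J L" if L: "proportional L L" for L
    proof -
      obtain l m n where lmn: "L = (l, m, n)" by (metis prod_cases3)
      have "(l, m, n) \<noteq> (0, 0, 0)" using L unfolding lmn proportional_iff_cross by simp
      from lies_on_both_iff[OF cr this] show ?thesis unfolding lmn p q by simp
    qed
    then show "\<exists>J\<in>{L. proportional L L}. \<forall>L\<in>{L. proportional L L}.
        ?on p L \<and> ?on q L \<longleftrightarrow> proportional J L"
      using JJ by blast
  qed
  then show ?thesis by metis
qed

lemma lies_on_join:
  assumes "a \<noteq> b"
  shows "lies_on a (join a b)" and "lies_on b (join a b)"
  using theI'[OF join_exists_unique[OF assms]] unfolding join_def by auto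

lemma join_eqI:
  assumes "a \<noteq> b" "lies_on a L" "lies_on b L"
  shows "join a b = L"
  unfolding join_def using the1_equality[OF join_exists_unique[OF assms(1)]] assms(2,3) by blast

end

theory Submission
  imports Defs
begin

text \<open>
  In characteristic not two the null points are \<open>[t\<^sup>2 - u\<^sup>2 : 2tu : t\<^sup>2 + u\<^sup>2]\<close> for \<open>(t, u)\<close> on the
  projective line. With \<open>d i j = t\<^sub>i * u\<^sub>j - t\<^sub>j * u\<^sub>i\<close>, the line joining two of them has quadratic
  form \<open>(d i j)\<^sup>2\<close>, and two such lines have bilinear product \<open>- (d 1 3 * d 2 4 + d 1 4 * d 2 3)\<close>.
  Put \<open>A = d 1 2 * d 3 4\<close>, \<open>B = d 1 3 * d 2 4\<close>, \<open>C = d 1 4 * d 2 3\<close>. The Pluecker relation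
  \<open>A + C = B\<close> reduces the diagonal spreads to \<open>-4BC/A\<^sup>2\<close>, \<open>4AC/B\<^sup>2\<close>, \<open>-4AB/C\<^sup>2\<close>. Their product
  is 64, and the sum of their pairwise products is \<open>16(B\<^sup>3 - A\<^sup>3 - C\<^sup>3)/(ABC) = 48\<close>.
\<close>

definition null_triple :: "'a::field \<Rightarrow> 'a \<Rightarrow> 'a \<times> 'a \<times> 'a" where
  "null_triple t u = (t\<^sup>2 - u\<^sup>2, 2 * t * u, t\<^sup>2 + u\<^sup>2)"

text \<open>The polarization of \<open>null_triple\<close>. Multiplied by -2 * (t * u' - t' * u), it
  is the cross product of the two null triples with last entry negated, so it represents their
  join.\<close>

definition chord_triple :: "'a::field \<Rightarrow> 'a \<Rightarrow> 'a \<Rightarrow> 'a \<Rightarrow> 'a \<times> 'a \<times> 'a" where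
  "chord_triple t u t' u' = (t * t' - u * u', t * u' + t' * u, t * t' + u * u')"

lemma two_neq_zero:
  assumes "CHAR('a::field) \<noteq> 2"
  shows "(2 :: 'a) \<noteq> 0"
proof
  assume "(2 :: 'a) = 0"
  then have "of_nat 2 = (0 :: 'a)" by simp
  then have "CHAR('a) dvd 2" unfolding of_nat_eq_0_iff_char_dvd .
  then have "CHAR('a) = 1 \<or> CHAR('a) = 2"
    using prime_nat_iff two_is_prime_nat by blast
  with assms show False by simp
qed

text \<open>The quotient is partial, so reflexivity marks its domain; this discharges the side
  conditions of the \<open>abs_eq\<close> rules.\<close>

lemma proportional_refl_iff: "proportional p p \<longleftrightarrow> p \<noteq> (0, 0, 0)"
  by (cases p) (auto simp: proportional_triple intro!: exI[of _ 1])

lemma null_triple_nonzero: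
  fixes t u :: "'a::field"
  assumes two: "(2 :: 'a) \<noteq> 0" and tu: "(t, u) \<noteq> (0, 0)"
  shows "null_triple t u \<noteq> (0, 0, 0)"
proof
  assume "null_triple t u = (0, 0, 0)"
  then have e: "t\<^sup>2 - u\<^sup>2 = 0" "t\<^sup>2 + u\<^sup>2 = 0" by (auto simp: null_triple_def)
  then have "2 * t\<^sup>2 = 0" "2 * u\<^sup>2 = 0" by algebra+
  with two tu show False by simp
qed

text \<open>Stereographic projection from [-1 : 0 : 1]: since z + x = 2 * t^2 and y = 2 * t * u on
  the parametrized triples, the parameter t : u is z + x : y away from the centre.\<close>

lemma null_pointE:
  fixes a :: "'a::field point"
  assumes two: "(2 :: 'a) \<noteq> 0" and "null a"
  obtains t u where "(t, u) \<noteq> (0, 0)" "a = abs_proportion (null_triple t u)"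
proof -
  obtain x y z where a: "a = abs_proportion (x, y, z)" and nz: "(x, y, z) \<noteq> (0, 0, 0)"
    by (metis prod_cases3 proportional_refl_iff Quotient_proportion Quotient_abs_rep
        Quotient_rep_reflp)
  have n: "x\<^sup>2 + y\<^sup>2 - z\<^sup>2 = 0"
    using \<open>null a\<close> nz unfolding a by (simp add: null.abs_eq proportional_refl_iff)
  show thesis
  proof (cases "z + x = 0")
    case False
    \<comment> \<open>The scalar comes from y^2 = (z - x) * (z + x), which makes z + x a common
      factor.\<close>
    define c where "c = 2 * (z + x)"
    have "null_triple (z + x) y = (c * x, c * y, c * z)"
      using n unfolding null_triple_def c_def prod.inject by (intro conjI, algebra, simp, algebra)
    moreover have "c \<noteq> 0" using two False by (simp add: c_def del: distrib_left_numeral)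
    ultimately have "proportional (x, y, z) (null_triple (z + x) y)"
      using nz by (auto simp: proportional_triple)
    then show ?thesis
      using that[of "z + x" y] False a Quotient_rel_abs[OF Quotient_proportion] by blast
  next
    case True
    then have z: "z = - x" by algebra
    with n have y: "y = 0" by simp
    \<comment> \<open>Only the centre of projection remains, and (0, 1) parametrizes it.\<close>
    have "proportional (x, y, z) (null_triple 0 1)"
      using nz unfolding null_triple_def proportional_iff_cross cross_def z y by simp
    then show ?thesis
      using that[of 0 1] a Quotient_rel_abs[OF Quotient_proportion]
      by (metis prod.inject zero_neq_one)
  qed
qed

text \<open>Every entry of the cross product is divisible by t * u' - t' * u. Contraposed, distinct
  null points have a non-zero determinant.\<close>

lemma null_triples_proportional:
  fixes t u t' u' :: "'a::field"
  assumes "(2 :: 'a) \<noteq> 0" "(t, u) \<noteq> (0, 0)" "(t', u') \<noteq> (0, 0)" "t * u' - t' * u = 0"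
  shows "proportional (null_triple t u) (null_triple t' u')"
proof -
  have "cross (null_triple t u) (null_triple t' u') = (0, 0, 0)"
    using assms(4) unfolding cross_def null_triple_def by (simp, intro conjI) algebra+
  then show ?thesis
    using assms by (simp add: proportional_iff_cross null_triple_nonzero)
qed

text \<open>The squares of tt' - uu' and tt' + uu' differ by 4tt'uu', which turns (tu' + t'u)^2 into
  (tu' - t'u)^2. Joins of distinct null points are therefore non-null, and the spread denominators
  do not vanish.\<close>

lemma chord_norm:
  "(case chord_triple t u t' u' of (l, m, n) \<Rightarrow> l\<^sup>2 + m\<^sup>2 - n\<^sup>2) = (t * u' - t' * u)\<^sup>2"
  unfolding chord_triple_def prod.case by algebra

lemma chord_triple_nonzero:
  "t * u' - t' * u \<noteq> 0 \<Longrightarrow> chord_triple t u t' u' \<noteq> (0, 0, 0)"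
  using chord_norm[of t u t' u'] by auto

lemma join_null_points:
  fixes t u t' u' :: "'a::field"
  assumes two: "(2 :: 'a) \<noteq> 0" and nz: "(t, u) \<noteq> (0, 0)" "(t', u') \<noteq> (0, 0)"
    and ne: "abs_proportion (null_triple t u) \<noteq> abs_proportion (null_triple t' u')"
  shows "t * u' - t' * u \<noteq> 0"
    and "join (abs_proportion (null_triple t u)) (abs_proportion (null_triple t' u')) =
      abs_proportion (chord_triple t u t' u')"
proof -
  show d: "t * u' - t' * u \<noteq> 0"
    using null_triples_proportional[OF two nz] ne Quotient_rel_abs[OF Quotient_proportion]
    by blast
  have c: "proportional (chord_triple t u t' u') (chord_triple t u t' u')"
    using chord_triple_nonzero[OF d] by (simp add: proportional_refl_iff)
  have p: "proportional (null_triple t u) (null_triple t u)"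
      "proportional (null_triple t' u') (null_triple t' u')"
    using null_triple_nonzero[OF two] nz by (auto simp: proportional_refl_iff)
  have "lies_on (abs_proportion (null_triple t u)) (abs_proportion (chord_triple t u t' u'))"
    unfolding lies_on.abs_eq[OF p(1) c]
    unfolding null_triple_def chord_triple_def prod.case by algebra
  moreover
  have "lies_on (abs_proportion (null_triple t' u')) (abs_proportion (chord_triple t u t' u'))"
    unfolding lies_on.abs_eq[OF p(2) c]
    unfolding null_triple_def chord_triple_def prod.case by algebra
  ultimately show "join (abs_proportion (null_triple t u)) (abs_proportion (null_triple t' u')) =
      abs_proportion (chord_triple t u t' u')"
    using ne by (intro join_eqI)
qed

lemma spread_chords:
  fixes t\<^sub>1 u\<^sub>1 t\<^sub>2 u\<^sub>2 t\<^sub>3 u\<^sub>3 t\<^sub>4 u\<^sub>4 :: "'a::field"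
  assumes d: "t\<^sub>1 * u\<^sub>2 - t\<^sub>2 * u\<^sub>1 \<noteq> 0" "t\<^sub>3 * u\<^sub>4 - t\<^sub>4 * u\<^sub>3 \<noteq> 0"
  shows "spread (abs_proportion (chord_triple t\<^sub>1 u\<^sub>1 t\<^sub>2 u\<^sub>2)) (abs_proportion (chord_triple t\<^sub>3 u\<^sub>3 t\<^sub>4 u\<^sub>4)) =
    - 4 * ((t\<^sub>1 * u\<^sub>3 - t\<^sub>3 * u\<^sub>1) * (t\<^sub>2 * u\<^sub>4 - t\<^sub>4 * u\<^sub>2)) * ((t\<^sub>1 * u\<^sub>4 - t\<^sub>4 * u\<^sub>1) * (t\<^sub>2 * u\<^sub>3 - t\<^sub>3 * u\<^sub>2))
      / ((t\<^sub>1 * u\<^sub>2 - t\<^sub>2 * u\<^sub>1) * (t\<^sub>3 * u\<^sub>4 - t\<^sub>4 * u\<^sub>3))\<^sup>2"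
    (is "?S = - 4 * ?B * ?C / ?A\<^sup>2")
proof -
  obtain l m n where L: "chord_triple t\<^sub>1 u\<^sub>1 t\<^sub>2 u\<^sub>2 = (l, m, n)" by (metis prod_cases3)
  obtain l' m' n' where L': "chord_triple t\<^sub>3 u\<^sub>3 t\<^sub>4 u\<^sub>4 = (l', m', n')" by (metis prod_cases3)
  have c: "proportional (l, m, n) (l, m, n)" "proportional (l', m', n') (l', m', n')"
    using chord_triple_nonzero[OF d(1)] chord_triple_nonzero[OF d(2)]
    unfolding L L' by (simp_all add: proportional_refl_iff)
  have A: "(l\<^sup>2 + m\<^sup>2 - n\<^sup>2) * (l'\<^sup>2 + m'\<^sup>2 - n'\<^sup>2) = ?A\<^sup>2"
    using chord_norm[of t\<^sub>1 u\<^sub>1 t\<^sub>2 u\<^sub>2] chord_norm[of t\<^sub>3 u\<^sub>3 t\<^sub>4 u\<^sub>4]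
    unfolding L L' by (simp add: power_mult_distrib)
  have BC: "l * l' + m * m' - n * n' = - (?B + ?C)"
  proof -
    have lmn: "l = t\<^sub>1 * t\<^sub>2 - u\<^sub>1 * u\<^sub>2" "m = t\<^sub>1 * u\<^sub>2 + t\<^sub>2 * u\<^sub>1" "n = t\<^sub>1 * t\<^sub>2 + u\<^sub>1 * u\<^sub>2"
        "l' = t\<^sub>3 * t\<^sub>4 - u\<^sub>3 * u\<^sub>4" "m' = t\<^sub>3 * u\<^sub>4 + t\<^sub>4 * u\<^sub>3" "n' = t\<^sub>3 * t\<^sub>4 + u\<^sub>3 * u\<^sub>4"
      using L L' by (simp_all add: chord_triple_def)
    show ?thesis unfolding lmn by algebra
  qed
  have pluecker: "?A = ?B - ?C" by (simp add: algebra_simps)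
  have A0: "?A\<^sup>2 \<noteq> 0" using d by simp
  have "1 - (- (?B + ?C))\<^sup>2 / ?A\<^sup>2 = (?A\<^sup>2 - (?B + ?C)\<^sup>2) / ?A\<^sup>2"
    unfolding power2_minus diff_divide_distrib divide_self[OF A0] ..
  \<comment> \<open>Difference of squares: with A = B - C the factors are -2C and 2B.\<close>
  also have "?A\<^sup>2 - (?B + ?C)\<^sup>2 = - 4 * ?B * ?C" unfolding pluecker by algebra
  finally show ?thesis
    unfolding L L' spread.abs_eq[OF c] prod.case A BC .
qed

lemma spread_identities:
  fixes A B C :: "'a::field"
  assumes nz: "A \<noteq> 0" "B \<noteq> 0" "C \<noteq> 0" and sum: "A + C = B"
    and P: "P = - 4 * B * C / A\<^sup>2" and R: "R = 4 * A * C / B\<^sup>2" and T: "T = - 4 * A * B / C\<^sup>2"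
  shows "P * R + R * T + T * P = 48" and "P * R * T = 64"
proof -
  have "P * R + R * T + T * P = 16 * (B ^ 3 - A ^ 3 - C ^ 3) / (A * B * C)"
    unfolding P R T using nz by (simp add: field_simps power2_eq_square power3_eq_cube)
  \<comment> \<open>This is (A + C)^3 - A^3 - C^3 = 3AC(A + C).\<close>
  also have "16 * (B ^ 3 - A ^ 3 - C ^ 3) = 48 * (A * B * C)"
    unfolding sum[symmetric] by algebra
  finally show "P * R + R * T + T * P = 48" using nz by simp
  show "P * R * T = 64"
    unfolding P R T using nz by (simp add: field_simps power2_eq_square)
qed

theorem theorem92:
  fixes \<alpha>\<^sub>1 \<alpha>\<^sub>2 \<alpha>\<^sub>3 \<alpha>\<^sub>4 :: "'a::field point" and P R T :: 'a
  assumes char: "CHAR('a) \<noteq> 2"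
    and distinct: "distinct [\<alpha>\<^sub>1, \<alpha>\<^sub>2, \<alpha>\<^sub>3, \<alpha>\<^sub>4]"
    and null: "null \<alpha>\<^sub>1" "null \<alpha>\<^sub>2" "null \<alpha>\<^sub>3" "null \<alpha>\<^sub>4"
    and P: "P = spread (join \<alpha>\<^sub>1 \<alpha>\<^sub>2) (join \<alpha>\<^sub>3 \<alpha>\<^sub>4)"
    and R: "R = spread (join \<alpha>\<^sub>1 \<alpha>\<^sub>3) (join \<alpha>\<^sub>2 \<alpha>\<^sub>4)"
    and T: "T = spread (join \<alpha>\<^sub>1 \<alpha>\<^sub>4) (join \<alpha>\<^sub>2 \<alpha>\<^sub>3)"
  shows "P * R + R * T + T * P = 48 \<and> P * R * T = 64"
proof -
  note two = two_neq_zero[OF char]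
  obtain t\<^sub>1 u\<^sub>1 where 1: "(t\<^sub>1, u\<^sub>1) \<noteq> (0, 0)" "\<alpha>\<^sub>1 = abs_proportion (null_triple t\<^sub>1 u\<^sub>1)"
    using null_pointE[OF two null(1)] .
  obtain t\<^sub>2 u\<^sub>2 where 2: "(t\<^sub>2, u\<^sub>2) \<noteq> (0, 0)" "\<alpha>\<^sub>2 = abs_proportion (null_triple t\<^sub>2 u\<^sub>2)"
    using null_pointE[OF two null(2)] .
  obtain t\<^sub>3 u\<^sub>3 where 3: "(t\<^sub>3, u\<^sub>3) \<noteq> (0, 0)" "\<alpha>\<^sub>3 = abs_proportion (null_triple t\<^sub>3 u\<^sub>3)"
    using null_pointE[OF two null(3)] .
  obtain t\<^sub>4 u\<^sub>4 where 4: "(t\<^sub>4, u\<^sub>4) \<noteq> (0, 0)" "\<alpha>\<^sub>4 = abs_proportion (null_triple t\<^sub>4 u\<^sub>4)"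
    using null_pointE[OF two null(4)] .
  have ne: "\<alpha>\<^sub>1 \<noteq> \<alpha>\<^sub>2" "\<alpha>\<^sub>3 \<noteq> \<alpha>\<^sub>4" "\<alpha>\<^sub>1 \<noteq> \<alpha>\<^sub>3" "\<alpha>\<^sub>2 \<noteq> \<alpha>\<^sub>4" "\<alpha>\<^sub>1 \<noteq> \<alpha>\<^sub>4" "\<alpha>\<^sub>2 \<noteq> \<alpha>\<^sub>3"
    using distinct by auto
  note j12 = join_null_points[OF two 1(1) 2(1) ne(1)[unfolded 1(2) 2(2)], folded 1(2) 2(2)]
  note j34 = join_null_points[OF two 3(1) 4(1) ne(2)[unfolded 3(2) 4(2)], folded 3(2) 4(2)]
  note j13 = join_null_points[OF two 1(1) 3(1) ne(3)[unfolded 1(2) 3(2)], folded 1(2) 3(2)]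
  note j24 = join_null_points[OF two 2(1) 4(1) ne(4)[unfolded 2(2) 4(2)], folded 2(2) 4(2)]
  note j14 = join_null_points[OF two 1(1) 4(1) ne(5)[unfolded 1(2) 4(2)], folded 1(2) 4(2)]
  note j23 = join_null_points[OF two 2(1) 3(1) ne(6)[unfolded 2(2) 3(2)], folded 2(2) 3(2)]
  define A where "A = (t\<^sub>1 * u\<^sub>2 - t\<^sub>2 * u\<^sub>1) * (t\<^sub>3 * u\<^sub>4 - t\<^sub>4 * u\<^sub>3)"
  define B where "B = (t\<^sub>1 * u\<^sub>3 - t\<^sub>3 * u\<^sub>1) * (t\<^sub>2 * u\<^sub>4 - t\<^sub>4 * u\<^sub>2)"
  define C where "C = (t\<^sub>1 * u\<^sub>4 - t\<^sub>4 * u\<^sub>1) * (t\<^sub>2 * u\<^sub>3 - t\<^sub>3 * u\<^sub>2)"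
  have nz: "A \<noteq> 0" "B \<noteq> 0" "C \<noteq> 0"
    unfolding A_def B_def C_def using j12(1) j34(1) j13(1) j24(1) j14(1) j23(1) by simp_all
  have sum: "A + C = B" unfolding A_def B_def C_def by algebra
  have P': "P = - 4 * B * C / A\<^sup>2"
    unfolding P j12(2) j34(2) spread_chords[OF j12(1) j34(1)] A_def B_def C_def ..
  \<comment> \<open>Exchanging indices 2 and 3 sends the products A, B, C to B, A, -C, hence the
    positive sign.\<close>
  have R': "R = 4 * A * C / B\<^sup>2"
    unfolding R j13(2) j24(2) spread_chords[OF j13(1) j24(1)] B_def[symmetric]
    by (rule arg_cong[where f = "\<lambda>x. x / B\<^sup>2"]) (unfold A_def C_def, algebra)
  \<comment> \<open>Here the index order 1, 4, 2, 3 sends A, B, C to C, -A, -B, and the two signs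
    cancel.\<close>
  have T': "T = - 4 * A * B / C\<^sup>2"
    unfolding T j14(2) j23(2) spread_chords[OF j14(1) j23(1)] C_def[symmetric]
    by (rule arg_cong[where f = "\<lambda>x. x / C\<^sup>2"]) (unfold A_def B_def, algebra)
  show ?thesis using spread_identities[OF nz sum P' R' T'] by blast
qed

end
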